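(* Let $A=\{a_0<a_1<a_2<\dots<a_{k-1}\}\subset\mathbb{Z}$ be a finite set of integers of size $|A|=k\ge 1$. Then for every integer $r\ge 3$ we have $$|A+r\ast A|\ge\max(4k-4,1)\ge 3k-2.$$
   Context: For a positive integer $r$ and a finite set $A\subseteq\mathbb{Z}$, $r\ast A=\{rx: x\in A\}$, and $A+r\ast A=\{x+ry: x,y\in A\}$. $|X|$ denotes the size of a finite set $X$. *)

theory Defs
  imports Main "HOL-Library.Set_Algebras"
begin

end

theory Submission imports Defs begin

text \<open>
  Induct on the size \<open>k\<close> of \<open>A\<close>, and normalise so that the differences of \<open>A\<close> have gcd 1.  If \<open>A\<close>
  meets three classes modulo \<open>r\<close>, then splitting \<open>A\<close> by classes and using
  \<open>|X + Y| \<ge> |X| + |Y| - 1\<close> gives \<open>k + 3 (k - 1)\<close>.  Otherwise \<open>A = A1 \<union> A2\<close> with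
  \<open>Ai = ui + r Bi\<close> and \<open>|A + r A| = |B1 + A| + |B2 + A|\<close>.  With \<open>d = u2 - u1\<close>, either some class
  of \<open>B1\<close> leaves \<open>B1\<close> modulo \<open>r\<close> when shifted by \<open>d\<close>, so that \<open>B1 + A2\<close> contributes at
  least \<open>|A2|\<close> elements outside \<open>B1 + A1\<close>, which the induction hypothesis controls; or the classes
  of \<open>B1\<close> are closed under the shift, so there are at least three of them (the gcd condition
  excludes \<open>2 d \<equiv> 0\<close>) and \<open>|B1 + Aj| \<ge> |B1| + 3 (|Aj| - 1)\<close> for both \<open>j\<close>; moreover
  \<open>B1 + A1 \<noteq> B1 + A2\<close> because their minima differ, which gains the one element needed when
  \<open>|A1| = |A2|\<close>.  The same holds for \<open>B2\<close>.
\<close>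

section \<open>Lower bounds for sumsets of integers\<close>

lemma card_sumset_ge:
  fixes X Y :: "int set"
  assumes "finite X" "finite Y" "X \<noteq> {}" "Y \<noteq> {}"
  shows "card X + card Y \<le> card (X + Y) + 1"
proof -
  \<comment> \<open>Elements of \<open>?P\<close> are at most \<open>Max X + Min Y\<close> and
    elements of \<open>?Q\<close> are at least that, so these two translates inside
    \<open>X + Y\<close> share at most this point.\<close>
  let ?P = "(\<lambda>x. x + Min Y) ` X" and ?Q = "(\<lambda>y. Max X + y) ` Y"
  have "?P \<inter> ?Q \<subseteq> {Max X + Min Y}"
  proof
    fix z assume "z \<in> ?P \<inter> ?Q"
    then obtain x y where xy: "x \<in> X" "y \<in> Y" "z = x + Min Y" "z = Max X + y" by auto
    moreover have "x \<le> Max X" "Min Y \<le> y" using xy assms by auto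
    ultimately show "z \<in> {Max X + Min Y}" by auto
  qed
  then have "card (?P \<inter> ?Q) \<le> 1"
    using card_mono[of "{Max X + Min Y}"] by fastforce
  moreover have "card ?P = card X" "card ?Q = card Y"
    by (auto intro!: card_image simp: inj_on_def)
  moreover have "card ?P + card ?Q = card (?P \<union> ?Q) + card (?P \<inter> ?Q)"
    using assms by (intro card_Un_Int) auto
  moreover have "card (?P \<union> ?Q) \<le> card (X + Y)"
    using assms by (intro card_mono finite_set_plus) (auto intro!: set_plus_intro Min_in Max_in)
  ultimately show ?thesis by linarith
qed

lemma card_sumset_ge_right:
  fixes X Y :: "int set"
  assumes "finite X" "finite Y" "X \<noteq> {}"
  shows "card Y \<le> card (X + Y)"
proof (cases "Y = {}")
  case False
  moreover have "card X \<ge> 1" using assms by (simp add: Suc_leI card_gt_0_iff)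
  ultimately show ?thesis using card_sumset_ge[of X Y] assms by linarith
qed simp

lemma sumset_neq_of_disjoint:
  fixes B X Y :: "int set"
  assumes "finite B" "B \<noteq> {}" "finite X" "finite Y" "X \<noteq> {}" "Y \<noteq> {}" "X \<inter> Y = {}"
  shows "B + X \<noteq> B + Y"
proof
  have Min_sumset: "Min (B + S) = Min B + Min S" if "finite S" "S \<noteq> {}" for S
  proof (rule Min_eqI)
    show "finite (B + S)" using assms that by (simp add: finite_set_plus)
    show "Min B + Min S \<in> B + S" using assms that by (intro set_plus_intro) auto
    show "Min B + Min S \<le> z" if "z \<in> B + S" for z
      using that assms \<open>finite S\<close> by (auto simp: set_plus_def intro: add_mono)
  qed
  assume "B + X = B + Y"
  then have "Min X = Min Y" using Min_sumset[of X] Min_sumset[of Y] assms by auto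
  then show False using Min_in[of X] Min_in[of Y] assms by (metis disjoint_iff)
qed

section \<open>Splitting by residue classes modulo \<open>r\<close>\<close>

lemma card_sumset_split:
  fixes X Y S :: "int set"
  assumes fin: "finite X" "finite Y" "finite S"
    and S: "\<And>s t. s \<in> S \<Longrightarrow> t \<in> S \<Longrightarrow> r dvd s - t"
    and XY: "\<And>x y. x \<in> X \<Longrightarrow> y \<in> Y \<Longrightarrow> \<not> r dvd x - y"
  shows "card ((X \<union> Y) + S) = card (X + S) + card (Y + S)"
proof -
  have "x + s \<noteq> y + t" if "x \<in> X" "y \<in> Y" "s \<in> S" "t \<in> S" for x y s t
  proof
    assume "x + s = y + t"
    then have "x - y = t - s" by simp
    then show False using S that XY by metis
  qed
  then have "(X + S) \<inter> (Y + S) = {}" by (fastforce simp: set_plus_def)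
  moreover have "(X \<union> Y) + S = (X + S) \<union> (Y + S)" by (auto simp: set_plus_def)
  ultimately show ?thesis using fin by (simp add: card_Un_disjoint finite_set_plus)
qed

text \<open>The class of \<open>x\<close>, the class of \<open>y\<close> and all the rest have
  disjoint sumsets with \<open>S\<close>, and each loses at most 1 against the sum of the sizes. The
  rest may consist of several classes.\<close>

lemma card_sumset_three_classes:
  fixes B S :: "int set"
  assumes fin: "finite B" "finite S" "S \<noteq> {}"
    and S: "\<And>s t. s \<in> S \<Longrightarrow> t \<in> S \<Longrightarrow> r dvd s - t"
    and B: "x \<in> B" "y \<in> B" "z \<in> B"
    and ne: "\<not> r dvd x - y" "\<not> r dvd x - z" "\<not> r dvd y - z"
  shows "card B + 3 * card S \<le> card (B + S) + 3"
proof -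
  let ?X = "{b \<in> B. r dvd b - x}" and ?Y = "{b \<in> B. r dvd b - y}"
  let ?Z = "{b \<in> B. \<not> r dvd b - x \<and> \<not> r dvd b - y}"
  have sep: "\<not> r dvd b - c" if "r dvd b - p" "\<not> r dvd c - p" for b c p :: int
    using dvd_diff[OF that(1), of "b - c"] that(2) by auto
  have YX: "\<not> r dvd c - x" if "r dvd c - y" for c
    using dvd_diff[OF that, of "c - x"] ne(1) by auto
  have "card ((?X \<union> (?Y \<union> ?Z)) + S) = card (?X + S) + card ((?Y \<union> ?Z) + S)"
    using fin S by (intro card_sumset_split) (auto dest: sep YX)
  moreover have "card ((?Y \<union> ?Z) + S) = card (?Y + S) + card (?Z + S)"
    using fin S by (intro card_sumset_split) (auto dest: sep)
  moreover have "?X \<union> (?Y \<union> ?Z) = B" by blast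
  moreover have "card ?X + (card ?Y + card ?Z) = card (?X \<union> (?Y \<union> ?Z))"
    using fin by (subst card_Un_disjoint; (subst card_Un_disjoint)?) (auto dest: YX)
  moreover have "?X \<noteq> {}" "?Y \<noteq> {}" using B by (auto intro: exI[of _ x] exI[of _ y])
  moreover have "z \<in> ?Z" using B ne by (auto simp: dvd_diff_commute)
  then have "?Z \<noteq> {}" by blast
  ultimately show ?thesis
    using card_sumset_ge[of ?X S] card_sumset_ge[of ?Y S] card_sumset_ge[of ?Z S] fin by simp
qed

text \<open>The two alternatives reflect whether the residues of \<open>B\<close> fail to be closed,
  or are closed, under translation by \<open>v - u\<close>. The first keeps
  \<open>card (B + A1)\<close> so that an inductive bound can be inserted.\<close>

lemma card_sumset_two_classes:
  fixes A1 A2 B :: "int set"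
  assumes fin: "finite B" "finite A1" "finite A2" and ne: "B \<noteq> {}" "A1 \<noteq> {}" "A2 \<noteq> {}"
    and A1: "\<And>a. a \<in> A1 \<Longrightarrow> r dvd a - u" and A2: "\<And>a. a \<in> A2 \<Longrightarrow> r dvd a - v"
    and d: "\<not> r dvd v - u" "\<not> r dvd 2 * (v - u)"
  shows "card (B + (A1 \<union> A2)) \<ge> card (B + A1) + card A2
    \<or> card B \<ge> 3
      \<and> card (B + (A1 \<union> A2)) + 3 \<ge> card B + 3 * card A1
      \<and> card (B + (A1 \<union> A2)) + 3 \<ge> card B + 3 * card A2
      \<and> (card A1 = card A2 \<longrightarrow> card (B + (A1 \<union> A2)) + 2 \<ge> card B + 3 * card A1)"
proof (cases "\<exists>b\<in>B. \<forall>c\<in>B. \<not> r dvd c - (b + (v - u))")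
  case True
  then obtain b where b: "b \<in> B" "\<And>c. c \<in> B \<Longrightarrow> \<not> r dvd c - (b + (v - u))" by blast
  \<comment> \<open>Equality would put \<open>c\<close> in the class of \<open>b + (v - u)\<close>,
    which \<open>B\<close> misses.\<close>
  have "b + a \<noteq> c + a'" if "a \<in> A2" "c \<in> B" "a' \<in> A1" for a c a'
  proof
    assume "b + a = c + a'"
    then have "c - (b + (v - u)) = (a - v) - (a' - u)" by simp
    then show False using b(2)[OF \<open>c \<in> B\<close>] A1[OF \<open>a' \<in> A1\<close>] A2[OF \<open>a \<in> A2\<close>] by (metis dvd_diff)
  qed
  then have "(B + A1) \<inter> ({b} + A2) = {}" by (fastforce simp: set_plus_def)
  then have "card (B + A1) + card ({b} + A2) = card ((B + A1) \<union> ({b} + A2))"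
    using fin by (simp add: card_Un_disjoint finite_set_plus)
  also have "\<dots> \<le> card (B + (A1 \<union> A2))"
    using fin b by (intro card_mono finite_set_plus) (auto simp: set_plus_def)
  finally show ?thesis using card_sumset_ge_right[of "{b}" A2] fin by simp
next
  case False
  then have shift: "\<exists>c\<in>B. r dvd c - (b + (v - u))" if "b \<in> B" for b using that by blast
  \<comment> \<open>Shifting twice yields the residues of \<open>x\<close>, \<open>x + d\<close>,
    \<open>x + 2 * d\<close> with \<open>d = v - u\<close>; they are distinct because
    \<open>r\<close> divides neither \<open>d\<close> nor \<open>2 * d\<close>.\<close>
  obtain x where x: "x \<in> B" using ne by blast
  obtain y where y: "y \<in> B" "r dvd y - (x + (v - u))" using shift[OF x] by blast
  obtain z where z: "z \<in> B" "r dvd z - (y + (v - u))" using shift[OF y(1)] by blast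
  have xy: "\<not> r dvd x - y"
    using dvd_add[OF y(2), of "x - y"] d(1) by (auto simp: dvd_diff_commute)
  have yz: "\<not> r dvd y - z"
    using dvd_add[OF z(2), of "y - z"] d(1) by (auto simp: dvd_diff_commute)
  have xz: "\<not> r dvd x - z"
  proof
    assume "r dvd x - z"
    then have "r dvd - ((x - z) + ((z - (y + (v - u))) + (y - (x + (v - u)))))"
      using y z by (intro dvd_minus_iff[THEN iffD2] dvd_add)
    then show False using d(2) by (simp add: algebra_simps)
  qed
  have cong: "r dvd s - t" if "r dvd s - w" "r dvd t - w" for s t w :: int
    using dvd_diff[OF that] by simp
  have c1: "card B + 3 * card A1 \<le> card (B + A1) + 3"
    using fin ne A1 cong by (intro card_sumset_three_classes[OF _ _ _ _ x y(1) z(1) xy xz yz]) blast+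
  have c2: "card B + 3 * card A2 \<le> card (B + A2) + 3"
    using fin ne A2 cong by (intro card_sumset_three_classes[OF _ _ _ _ x y(1) z(1) xy xz yz]) blast+
  have un: "B + (A1 \<union> A2) = (B + A1) \<union> (B + A2)" by (auto simp: set_plus_def)
  have m: "card (B + A1) \<le> card (B + (A1 \<union> A2))" "card (B + A2) \<le> card (B + (A1 \<union> A2))"
    unfolding un using fin by (auto intro!: card_mono finite_set_plus)
  have "x \<noteq> y" "y \<noteq> z" "x \<noteq> z" using xy yz xz by auto
  then have "3 = card {x, y, z}" by simp
  also have "\<dots> \<le> card B" using fin x y z by (intro card_mono) auto
  finally have B3: "3 \<le> card B" .
  have "A1 \<inter> A2 = {}"
  proof (rule ccontr)
    assume "A1 \<inter> A2 \<noteq> {}"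
    then obtain a where "r dvd a - u" "r dvd a - v" using A1 A2 by blast
    then show False using d(1) dvd_diff[of r "a - u" "a - v"] by simp
  qed
  then have neq: "B + A1 \<noteq> B + A2" using fin ne by (intro sumset_neq_of_disjoint) auto
  \<comment> \<open>If this failed, \<open>c1\<close>, \<open>c2\<close> and \<open>m\<close> would
    all be tight, so \<open>B + A1\<close> and \<open>B + A2\<close> would both fill the union and
    coincide.\<close>
  have "card B + 3 * card A1 \<le> card (B + (A1 \<union> A2)) + 2" if "card A1 = card A2"
  proof (rule ccontr)
    assume "\<not> ?thesis"
    then have "card (B + (A1 \<union> A2)) = card (B + A1)" "card (B + (A1 \<union> A2)) = card (B + A2)"
      using c1 c2 m that by linarith+
    then have "B + A1 = B + (A1 \<union> A2)" "B + A2 = B + (A1 \<union> A2)"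
      using fin unfolding un by (intro card_subset_eq; simp add: finite_set_plus)+
    then show False using neq by simp
  qed
  then show ?thesis using B3 c1 c2 m by linarith
qed

section \<open>Affine images and dilates\<close>

lemma card_affine_sumset:
  fixes r u :: int and B S :: "int set"
  assumes "r \<noteq> 0"
  shows "card ((\<lambda>b. u + r * b) ` B + (r *o S)) = card (B + S)"
proof -
  have "(\<lambda>b. u + r * b) ` B + (r *o S) = (\<lambda>z. u + r * z) ` (B + S)" (is "?L = ?R")
  proof (rule set_eqI)
    fix z
    have "z \<in> ?L \<longleftrightarrow> (\<exists>b\<in>B. \<exists>s\<in>S. z = (u + r * b) + r * s)"
      by (auto simp: set_plus_def elt_set_times_def)
    also have "\<dots> \<longleftrightarrow> (\<exists>b\<in>B. \<exists>s\<in>S. z = u + r * (b + s))"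
      by (simp add: algebra_simps)
    also have "\<dots> \<longleftrightarrow> z \<in> ?R" by (auto simp: set_plus_def)
    finally show "z \<in> ?L \<longleftrightarrow> z \<in> ?R" .
  qed
  then show ?thesis using assms by (simp add: card_image inj_on_def)
qed

text \<open>Allows a set to be translated and divided by the gcd of its differences: the sumset is
  carried along by the injection \<open>z\<close> to \<open>u + r * u + g * z\<close>.\<close>

lemma card_affine_sumset_dilate:
  fixes g u r :: int and A :: "int set"
  assumes "g \<noteq> 0"
  shows "card ((\<lambda>b. u + g * b) ` A + (r *o ((\<lambda>b. u + g * b) ` A))) = card (A + (r *o A))"
proof -
  let ?f = "\<lambda>b. u + g * b"
  have "?f ` A + (r *o (?f ` A)) = (\<lambda>z. u + r * u + g * z) ` (A + (r *o A))" (is "?L = ?R")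
  proof (rule set_eqI)
    fix z
    have "z \<in> ?L \<longleftrightarrow> (\<exists>a\<in>A. \<exists>b\<in>A. z = (u + g * a) + r * (u + g * b))"
      by (auto simp: set_plus_def elt_set_times_def)
    also have "\<dots> \<longleftrightarrow> (\<exists>a\<in>A. \<exists>b\<in>A. z = u + r * u + g * (a + r * b))"
      by (simp add: algebra_simps)
    also have "\<dots> \<longleftrightarrow> z \<in> ?R" by (auto simp: set_plus_def elt_set_times_def)
    finally show "z \<in> ?L \<longleftrightarrow> z \<in> ?R" .
  qed
  then show ?thesis using assms by (simp add: card_image inj_on_def)
qed

lemma card_le_card_sumset_dilate:
  fixes A :: "int set"
  assumes "finite A" "A \<noteq> {}"
  shows "card A \<le> card (A + (r *o A))"
proof -
  have "r *o A = (*) r ` A" by (auto simp: elt_set_times_def)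
  then show ?thesis
    using card_sumset_ge_right[of "r *o A" A] assms by (simp add: add.commute)
qed

text \<open>Writing \<open>A1\<close> as \<open>u + r * B\<close> turns \<open>A1 + (r *o S)\<close>
  into an affine copy of \<open>B + S\<close>, which reduces the claim to the dichotomy for
  \<open>B\<close>.\<close>

lemma card_sumset_dilate_two_classes:
  fixes A1 A2 :: "int set" and r u v :: int
  assumes r: "r \<noteq> 0"
    and fin: "finite A1" "finite A2" and ne: "A1 \<noteq> {}" "A2 \<noteq> {}"
    and A1: "\<And>a. a \<in> A1 \<Longrightarrow> r dvd a - u" and A2: "\<And>a. a \<in> A2 \<Longrightarrow> r dvd a - v"
    and d: "\<not> r dvd v - u" "\<not> r dvd 2 * (v - u)"
  shows "card (A1 + (r *o (A1 \<union> A2))) \<ge> card (A1 + (r *o A1)) + card A2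
    \<or> card A1 \<ge> 3
      \<and> card (A1 + (r *o (A1 \<union> A2))) + 3 \<ge> 4 * card A1
      \<and> card (A1 + (r *o (A1 \<union> A2))) + 3 \<ge> card A1 + 3 * card A2
      \<and> (card A1 = card A2 \<longrightarrow> card (A1 + (r *o (A1 \<union> A2))) + 2 \<ge> 4 * card A1)"
proof -
  define B where "B = (\<lambda>a. (a - u) div r) ` A1"
  have img: "A1 = (\<lambda>b. u + r * b) ` B"
    unfolding B_def image_image using A1 by simp
  have "card A1 = card B"
    using r by (subst img) (simp add: card_image inj_on_def)
  moreover have "finite B" "B \<noteq> {}" unfolding B_def using fin ne by auto
  moreover have "card (A1 + (r *o S)) = card (B + S)" for S
    using r by (subst img) (simp add: card_affine_sumset)
  ultimately show ?thesis
    using card_sumset_two_classes[of B A1 A2 r u v] fin ne A1 A2 d by simp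
qed

text \<open>Here \<open>a\<close>, \<open>b\<close> are the class sizes, \<open>s1\<close>,
  \<open>s2\<close> the sizes of the classes' sumsets with the whole dilate, and \<open>t1\<close>,
  \<open>t2\<close> with their own dilates. Size at least 3 settles the mixed case, the clause for
  \<open>a = b\<close> the case of two second alternatives, and \<open>a \<le> t1\<close>,
  \<open>b \<le> t2\<close> cover singletons, where the bounds with 4 are void.\<close>

lemma four_times_sum_le:
  fixes a b n s1 s2 t1 t2 :: nat
  assumes "n = s1 + s2"
    and "t1 + b \<le> s1
      \<or> 3 \<le> a \<and> 4 * a \<le> s1 + 3 \<and> a + 3 * b \<le> s1 + 3 \<and> (a = b \<longrightarrow> 4 * a \<le> s1 + 2)"
    and "t2 + a \<le> s2
      \<or> 3 \<le> b \<and> 4 * b \<le> s2 + 3 \<and> b + 3 * a \<le> s2 + 3 \<and> (b = a \<longrightarrow> 4 * b \<le> s2 + 2)"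
    and "1 \<le> a" "1 \<le> b" "4 * a \<le> t1 + 4" "4 * b \<le> t2 + 4" "a \<le> t1" "b \<le> t2"
  shows "4 * (a + b) \<le> n + 4"
  using assms by (cases "a = 1"; cases "b = 1"; cases a b rule: linorder_cases; auto)

section \<open>The induction on the size of the set\<close>

lemma card_sumset_dilate_ge:
  fixes A :: "int set" and r :: int
  assumes r: "r \<ge> 3" and "finite A" "A \<noteq> {}"
  shows "4 * card A \<le> card (A + (r *o A)) + 4"
  using assms(2,3)
proof (induction "card A" arbitrary: A rule: less_induct)
  case less
  show ?case
  \<comment> \<open>For one point the bound is trivial; with a second point the gcd of the
    differences is nonzero.\<close>
  proof (cases "card A = 1")
    case False
    obtain p where p: "p \<in> A" using less.prems by blast
    define g where "g = Gcd ((\<lambda>a. a - p) ` A)"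
    have "\<exists>q\<in>A. q \<noteq> p"
      using False p less.prems by (metis is_singletonI' is_singleton_altdef)
    then have g0: "g \<noteq> 0" by (auto simp: g_def)
    have g_dvd: "g dvd a - p" if "a \<in> A" for a
      unfolding g_def using that by (intro Gcd_dvd) auto
    define C where "C = (\<lambda>a. (a - p) div g) ` A"
    have AC: "A = (\<lambda>c. p + g * c) ` C"
      unfolding C_def image_image using g_dvd by simp
    have cardC: "card C = card A"
      using g0 by (subst AC) (simp add: card_image inj_on_def)
    have sumC: "card (A + (r *o A)) = card (C + (r *o C))"
      by (subst (1 2) AC) (rule card_affine_sumset_dilate[OF g0])
    have finC: "finite C" using less.prems by (simp add: C_def)
    have C0: "0 \<in> C" unfolding C_def using p by force
    \<comment> \<open>A common divisor \<open>q\<close> of \<open>C\<close> makes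
      \<open>q * g\<close> divide every difference, hence \<open>g\<close>. This is applied to
      \<open>r\<close>, to find a second class, and later to half of \<open>r\<close>.\<close>
    have prim: "is_unit q" if "\<And>c. c \<in> C \<Longrightarrow> q dvd c" for q
    proof -
      have "q * g dvd g"
        unfolding g_def
      proof (rule Gcd_greatest)
        fix e assume "e \<in> (\<lambda>a. a - p) ` A"
        then obtain c where "c \<in> C" "e = g * c" using AC by auto
        then show "q * Gcd ((\<lambda>a. a - p) ` A) dvd e"
          using that[of c] by (auto simp: g_def[symmetric] mult.commute)
      qed
      then show ?thesis using g0 by auto
    qed
    have rC: "r dvd s - t" if "s \<in> r *o C" "t \<in> r *o C" for s t
      using that by (auto simp: elt_set_times_def simp flip: right_diff_distrib)
    have fin_rC: "finite (r *o C)" and card_rC: "card (r *o C) = card C"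
    proof -
      have "r *o C = (*) r ` C" by (auto simp: elt_set_times_def)
      then show "finite (r *o C)" "card (r *o C) = card C"
        using finC r by (auto intro!: card_image simp: inj_on_def)
    qed
    have "\<not> is_unit r" using r by auto
    then obtain v where v: "v \<in> C" "\<not> r dvd v" using prim by blast
    have "4 * card C \<le> card (C + (r *o C)) + 4"
    proof (cases "\<exists>z\<in>C. \<not> r dvd z \<and> \<not> r dvd z - v")
      case True
      then obtain z where z: "z \<in> C" "\<not> r dvd z" "\<not> r dvd z - v" by blast
      have "r *o C \<noteq> {}" using C0 by (auto simp: elt_set_times_def)
      then have "card C + 3 * card (r *o C) \<le> card (C + (r *o C)) + 3"
        using card_sumset_three_classes[of C "r *o C" r z v 0] z v C0 finC fin_rC rC by simp
      then show ?thesis using card_rC by simp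
    next
      case two: False
      define C1 C2 where "C1 = {c \<in> C. r dvd c}" and "C2 = {c \<in> C. r dvd c - v}"
      have un: "C = C1 \<union> C2" using two by (auto simp: C1_def C2_def)
      have sep: "\<not> r dvd c - c'" if "c \<in> C1" "c' \<in> C2" for c c'
      proof
        assume "r dvd c - c'"
        moreover have "r dvd c" "r dvd c' - v" using that by (auto simp: C1_def C2_def)
        ultimately have "r dvd c - (c - c') - (c' - v)" by (meson dvd_diff)
        then show False using v by simp
      qed
      have fin: "finite C1" "finite C2" using finC by (auto simp: C1_def C2_def)
      have ne: "C1 \<noteq> {}" "C2 \<noteq> {}" using C0 v by (auto simp: C1_def C2_def)
      \<comment> \<open>Otherwise \<open>r = 2 * q\<close> with \<open>q dvd v\<close>, so
        \<open>q\<close> divides both classes and must be a unit, against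
        \<open>r \<ge> 3\<close>.\<close>
      have d: "\<not> r dvd 2 * v"
      proof
        assume r2v: "r dvd 2 * v"
        have "even r"
          using r2v v(2) coprime_dvd_mult_right_iff[of r 2 v] coprime_right_2_iff_odd[of r] by blast
        then obtain q where q: "r = 2 * q" by blast
        have q_dvd: "q dvd r" "q dvd v" using q r2v by simp_all
        have "q dvd c" if "c \<in> C" for c
        proof (cases "c \<in> C1")
          case True
          then show ?thesis using dvd_trans[OF q_dvd(1)] by (simp add: C1_def)
        next
          case False
          then have "c \<in> C2" using that un by blast
          then have "r dvd c - v" by (simp add: C2_def)
          from dvd_add[OF dvd_trans[OF q_dvd(1) this] q_dvd(2)] show ?thesis by simp
        qed
        then have "is_unit q" by (rule prim)
        then show False using q r by auto
      qed
      have dis: "C1 \<inter> C2 = {}" using sep by fastforce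
      then have cC: "card C = card C1 + card C2" using fin un by (simp add: card_Un_disjoint)
      have pos: "card C1 \<ge> 1" "card C2 \<ge> 1" using fin ne by (simp_all add: Suc_leI card_gt_0_iff)
      \<comment> \<open>Both classes are nonempty, so each is smaller than \<open>A\<close>.\<close>
      have IH: "4 * card C1 \<le> card (C1 + (r *o C1)) + 4" "4 * card C2 \<le> card (C2 + (r *o C2)) + 4"
        using less.hyps[of C1] less.hyps[of C2] cardC cC pos fin ne by auto
      have self: "card C1 \<le> card (C1 + (r *o C1))" "card C2 \<le> card (C2 + (r *o C2))"
        using fin ne by (simp_all add: card_le_card_sumset_dilate)
      have "card (C + (r *o C)) = card (C1 + (r *o C)) + card (C2 + (r *o C))"
        by (subst (1) un) (use fin fin_rC rC sep in \<open>intro card_sumset_split\<close>, auto)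
      moreover have "card (C1 + (r *o C)) \<ge> card (C1 + (r *o C1)) + card C2
        \<or> card C1 \<ge> 3 \<and> card (C1 + (r *o C)) + 3 \<ge> 4 * card C1
          \<and> card (C1 + (r *o C)) + 3 \<ge> card C1 + 3 * card C2
          \<and> (card C1 = card C2 \<longrightarrow> card (C1 + (r *o C)) + 2 \<ge> 4 * card C1)"
        unfolding un using r fin ne d v
        by (intro card_sumset_dilate_two_classes[where u = 0 and v = v])
           (auto simp: C1_def C2_def)
      \<comment> \<open>The classes swap roles and the shift becomes \<open>-v\<close>.\<close>
      moreover have "card (C2 + (r *o C)) \<ge> card (C2 + (r *o C2)) + card C1
        \<or> card C2 \<ge> 3 \<and> card (C2 + (r *o C)) + 3 \<ge> 4 * card C2
          \<and> card (C2 + (r *o C)) + 3 \<ge> card C2 + 3 * card C1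
          \<and> (card C2 = card C1 \<longrightarrow> card (C2 + (r *o C)) + 2 \<ge> 4 * card C2)"
        unfolding un Un_commute[of C1] using r fin ne d v
        by (intro card_sumset_dilate_two_classes[where u = v and v = 0])
           (auto simp: C1_def C2_def)
      ultimately show ?thesis
        unfolding cC using pos IH self by (rule four_times_sum_le)
    qed
    then show ?thesis using cardC sumC by simp
  qed simp
qed

theorem theorem6:
  fixes A :: "int set" and k :: nat and r :: int
  assumes "finite A" and "card A = k" and "k \<ge> 1" and "r \<ge> 3"
  shows "int (card (A + (r *o A))) \<ge> max (4 * int k - 4) 1
       \<and> max (4 * int k - 4) 1 \<ge> 3 * int k - 2"
proof -
  have ne: "A \<noteq> {}" using assms by auto
  \<comment> \<open>This supplies the 1 in the maximum, which matters only for
    \<open>k = 1\<close>.\<close>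
  then have "card A \<le> card (A + (r *o A))" by (rule card_le_card_sumset_dilate[OF assms(1)])
  then show ?thesis using card_sumset_dilate_ge[OF assms(4,1) ne] assms by linarith
qed

end
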